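(* For any positive integers $r_1, r_2, n$, the set of primitive semi-standard linked tableaux pairs (for the $n$-arrow Kronecker quiver with dimension vector $(r_1,r_2)$) is finite.
   Context: Fix positive integers $r_1,r_2,n$. A linked tableaux pair consists of the following data, for some $a\in \frac{1}{\gcd(r_1,r_2)}\mathbb{Z}_{\ge 0}$: (i) a filling $T^-$ of the rectangle with $r_1$ rows and $a r_2$ columns by double labels $ij$ with $1\le i\le n$, $1\le j\le r_2$; (ii) a filling $T^+$ of the rectangle with $r_2$ rows and $a r_1$ columns by double labels $ij$ with $1\le i\le n$, $1\le j\le r_1$; such that there exists a bijection (the link) from the boxes of $T^-$ to the boxes of $T^+$ taking each label $iq$ in row $p$ of $T^-$ to a label $ip$ in row $q$ of $T^+$. (For $a=0$ this is the empty pair.) Labels are ordered lexicographically: $ip<jq$ if $i<j$, or $i=j$ and $p<q$. A tableau is semi-standard if its rows are weakly increasing (left to right) and its columns strictly increasing (top to bottom). A linked pair $T^\pm=(T^+,T^-)$ is semi-standard if both $T^+$ and $T^-$ are semi-standard. Let $x^i_{jk}$ ($1\le i\le n$, $1\le j\le r_2$, $1\le k\le r_1$) be variables. The monomial of a linked pair is $\mathrm{Mon}(T^+)=\prod x^i_{kj}$, the product over all boxes of $T^+$, where a box in row $k$ with label $ij$ contributes $x^i_{kj}$ (the link ensures that this equals the analogous monomial of $T^-$, where a label $ik$ in row $j$ of $T^-$ contributes $x^i_{kj}$). A nonempty semi-standard linked pair $T^\pm$ is primitive if there do not exist nonempty semi-standard linked pairs $T_1^\pm$, $T_2^\pm$ with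 $\mathrm{Mon}(T^+)=\mathrm{Mon}(T_1^+)\,\mathrm{Mon}(T_2^+)$. *)

theory Defs
  imports Complex_Main
    "HOL-Library.FuncSet"
    "HOL-Library.Product_Lexorder"
    "HOL-Library.Poly_Mapping"
begin

text \<open>
  Rows, columns and both components of a label are numbered from 1. The label \<open>ij\<close> is the
  pair \<open>(i, j)\<close>, and the order on labels is the lexicographic one of
  \<^theory>\<open>HOL-Library.Product_Lexorder\<close>. A tableau maps the box \<open>(row, column)\<close> to its label.
\<close>

type_synonym box = "nat \<times> nat"
type_synonym label = "nat \<times> nat"
type_synonym tableau = "box \<Rightarrow> label"

definition boxes :: "nat \<Rightarrow> nat \<Rightarrow> box set" where
  "boxes r c = {1..r} \<times> {1..c}"

definition labels :: "nat \<Rightarrow> nat \<Rightarrow> label set" where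
  "labels n s = {1..n} \<times> {1..s}"

text \<open>
  Fillings are extensional functions, so that two fillings of the same rectangle are equal
  as soon as they agree on its boxes.
\<close>

definition fillings :: "nat \<Rightarrow> nat \<Rightarrow> nat \<Rightarrow> nat \<Rightarrow> tableau set" where
  "fillings r c n s = boxes r c \<rightarrow>\<^sub>E labels n s"

definition semistandard :: "nat \<Rightarrow> nat \<Rightarrow> tableau \<Rightarrow> bool" where
  "semistandard r c T \<longleftrightarrow>
     (\<forall>p\<in>{1..r}. mono_on {1..c} (\<lambda>d. T (p, d))) \<and>
     (\<forall>d\<in>{1..c}. strict_mono_on {1..r} (\<lambda>p. T (p, d)))"

text \<open>
  The number \<open>a\<close> is part of the data of a pair because it fixes the shapes of the two tableaux,
  which cannot be read off from the functions.
\<close>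

record tableaux_pair =
  scale :: rat
  minus_tab :: tableau
  plus_tab :: tableau

text \<open>
  For \<open>a \<in> (1 / gcd r1 r2) \<int>\<^sub>\<ge>\<^sub>0\<close> the product \<open>a * r\<close> with \<open>r = r1\<close> or \<open>r = r2\<close> is a natural number,
  and the floor below is exact.
\<close>

definition cols :: "rat \<Rightarrow> nat \<Rightarrow> nat" where
  "cols a r = nat \<lfloor>a * of_nat r\<rfloor>"

definition minus_boxes :: "nat \<Rightarrow> nat \<Rightarrow> rat \<Rightarrow> box set" where
  "minus_boxes r1 r2 a = boxes r1 (cols a r2)"

definition plus_boxes :: "nat \<Rightarrow> nat \<Rightarrow> rat \<Rightarrow> box set" where
  "plus_boxes r1 r2 a = boxes r2 (cols a r1)"

definition is_link :: "nat \<Rightarrow> nat \<Rightarrow> tableaux_pair \<Rightarrow> (box \<Rightarrow> box) \<Rightarrow> bool" where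
  "is_link r1 r2 T \<phi> \<longleftrightarrow>
     bij_betw \<phi> (minus_boxes r1 r2 (scale T)) (plus_boxes r1 r2 (scale T)) \<and>
     (\<forall>(p, c)\<in>minus_boxes r1 r2 (scale T). \<forall>i q.
        minus_tab T (p, c) = (i, q) \<longrightarrow>
        fst (\<phi> (p, c)) = q \<and> plus_tab T (\<phi> (p, c)) = (i, p))"

definition linked_pairs :: "nat \<Rightarrow> nat \<Rightarrow> nat \<Rightarrow> tableaux_pair set" where
  "linked_pairs n r1 r2 = {T.
     (\<exists>m::nat. scale T = of_nat m / of_nat (gcd r1 r2)) \<and>
     minus_tab T \<in> fillings r1 (cols (scale T) r2) n r2 \<and>
     plus_tab T \<in> fillings r2 (cols (scale T) r1) n r1 \<and>
     (\<exists>\<phi>. is_link r1 r2 T \<phi>)}"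

definition semistandard_pairs :: "nat \<Rightarrow> nat \<Rightarrow> nat \<Rightarrow> tableaux_pair set" where
  "semistandard_pairs n r1 r2 = {T \<in> linked_pairs n r1 r2.
     semistandard r1 (cols (scale T) r2) (minus_tab T) \<and>
     semistandard r2 (cols (scale T) r1) (plus_tab T)}"

definition nonempty_semistandard_pairs :: "nat \<Rightarrow> nat \<Rightarrow> nat \<Rightarrow> tableaux_pair set" where
  "nonempty_semistandard_pairs n r1 r2 = {T \<in> semistandard_pairs n r1 r2. scale T \<noteq> 0}"

text \<open>
  Polynomials with integer coefficients in the variables \<open>x\<^sup>i\<^sub>j\<^sub>k\<close>, indexed by the triples
  \<open>(i, j, k)\<close>: a polynomial assigns coefficients to exponent vectors, and multiplication is
  convolution.
\<close>

type_synonym polynomial = "((nat \<times> nat \<times> nat) \<Rightarrow>\<^sub>0 nat) \<Rightarrow>\<^sub>0 int"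

definition var :: "nat \<Rightarrow> nat \<Rightarrow> nat \<Rightarrow> polynomial" where
  "var i j k = Poly_Mapping.single (Poly_Mapping.single (i, j, k) 1) 1"

definition Mon :: "nat \<Rightarrow> nat \<Rightarrow> tableaux_pair \<Rightarrow> polynomial" where
  "Mon r1 r2 T =
     (\<Prod>(k, c)\<in>plus_boxes r1 r2 (scale T). case plus_tab T (k, c) of (i, j) \<Rightarrow> var i k j)"

definition primitive_pairs :: "nat \<Rightarrow> nat \<Rightarrow> nat \<Rightarrow> tableaux_pair set" where
  "primitive_pairs n r1 r2 = {T \<in> nonempty_semistandard_pairs n r1 r2.
     \<not> (\<exists>T1 \<in> nonempty_semistandard_pairs n r1 r2. \<exists>T2 \<in> nonempty_semistandard_pairs n r1 r2.
           Mon r1 r2 T = Mon r1 r2 T1 * Mon r1 r2 T2)}"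

end

theory Submission
  imports Defs "HOL-Library.Multiset"
begin

text \<open>
  A row of a semi-standard tableau is determined by its multiset of labels, and in terms of these
  multisets the column condition, the link and the shape are homogeneous linear equations and
  inequalities with integer coefficients. This is Gordan's lemma: adjoin the slacks of the
  inequalities as further coordinates. If one pair is dominated by another in all coordinates, the
  difference of their row multisets again comes from a semi-standard linked pair, so the larger
  pair is not primitive. By Dickson's lemma, infinitely many primitive pairs of pairwise different
  scales would contain two such pairs, and there are finitely many pairs of each scale.
\<close>

section \<open>Dickson's lemma\<close>

text \<open>The positions where \<open>u\<close> is minimal among all later values form an infinite
  set, and \<open>u\<close> increases weakly along them.\<close>

lemma mono_subsequence_nat:
  fixes u :: "nat \<Rightarrow> nat"
  shows "\<exists>h :: nat \<Rightarrow> nat. strict_mono h \<and> mono (u \<circ> h)"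
proof -
  define P where "P k \<longleftrightarrow> (\<forall>j\<ge>k. u k \<le> u j)" for k
  have ex: "\<exists>k\<ge>N. P k" for N
  proof -
    \<comment> \<open>A position where \<open>u\<close> attains its minimum over all indices from
      \<open>N\<close> on.\<close>
    obtain k where "k \<ge> N" "\<forall>j. j \<ge> N \<longrightarrow> u k \<le> u j"
      using ex_has_least_nat[of "\<lambda>k. k \<ge> N" N u] by auto
    then show ?thesis unfolding P_def by (intro exI[of _ k]) auto
  qed
  have "\<exists>h. \<forall>m. P (h m) \<and> h m < h (Suc m)"
  proof (rule dependent_nat_choice)
    show "\<exists>k. P k" using ex by blast
    show "\<exists>k'. P k' \<and> k < k'" for k using ex[of "Suc k"] by auto
  qed
  then obtain h where h: "\<And>m. P (h m)" "\<And>m. h m < h (Suc m)" by blast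
  then have "strict_mono h" by (simp add: strict_mono_Suc_iff)
  moreover have "mono (u \<circ> h)"
    using h(1) strict_mono_mono[OF \<open>strict_mono h\<close>] by (auto simp: P_def mono_def)
  ultimately show ?thesis by blast
qed

text \<open>Each new function thins the subsequence once more; monotonicity of the earlier ones
  survives in a subsequence.\<close>

lemma mono_subsequence_nat_family:
  fixes F :: "('a \<Rightarrow> nat) set" and s :: "nat \<Rightarrow> 'a"
  assumes "finite F"
  shows "\<exists>h :: nat \<Rightarrow> nat. strict_mono h \<and> (\<forall>f\<in>F. mono (\<lambda>k. f (s (h k))))"
  using assms
proof induction
  case empty
  show ?case using strict_mono_id by blast
next
  case (insert f F)
  then obtain h :: "nat \<Rightarrow> nat" where h: "strict_mono h" "\<forall>f\<in>F. mono (\<lambda>k. f (s (h k)))" by blast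
  obtain h' :: "nat \<Rightarrow> nat" where h': "strict_mono h'" "mono ((\<lambda>k. f (s (h k))) \<circ> h')"
    using mono_subsequence_nat by blast
  have "strict_mono (h \<circ> h')" using h h' by (simp add: strict_mono_o)
  moreover have "mono (\<lambda>k. f' (s ((h \<circ> h') k)))" if "f' \<in> insert f F" for f'
    using that h h' strict_mono_mono[OF h'(1)] by (auto simp: mono_def)
  ultimately show ?case by blast
qed

text \<open>The coordinates are a finite set of functions rather than the entries of a tuple, so the
  lemma applies directly to tableaux pairs. Two terms of a common monotone subsequence give
  \<open>i\<close> and \<open>j\<close>.\<close>

lemma dickson:
  fixes F :: "('a \<Rightarrow> nat) set" and s :: "nat \<Rightarrow> 'a"
  assumes "finite F"
  obtains i j where "i < j" "\<forall>f\<in>F. f (s i) \<le> f (s j)"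
proof -
  obtain h :: "nat \<Rightarrow> nat" where h: "strict_mono h" "\<forall>f\<in>F. mono (\<lambda>k. f (s (h k)))"
    using mono_subsequence_nat_family[OF assms] by blast
  show ?thesis
  proof (rule that)
    show "h 0 < h 1" using h(1) by (simp add: strict_mono_less)
    show "\<forall>f\<in>F. f (s (h 0)) \<le> f (s (h 1))"
      using h(2) monoD[where x = 0 and y = "1 :: nat"] by fastforce
  qed
qed

section \<open>Multisets and bijections\<close>

lemma image_mset_mset_set_Times:
  assumes "finite A" "finite B"
  shows "image_mset f (mset_set (A \<times> B)) = (\<Sum>a\<in>A. image_mset (\<lambda>b. f (a, b)) (mset_set B))"
  using assms(1)
proof induction
  case (insert a A)
  have "insert a A \<times> B = Pair a ` B \<union> A \<times> B" by auto
  moreover have "mset_set (Pair a ` B \<union> A \<times> B) = mset_set (Pair a ` B) + mset_set (A \<times> B)"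
    using insert assms(2) by (intro mset_set_Union) auto
  moreover have "mset_set (Pair a ` B) = image_mset (Pair a) (mset_set B)"
    by (simp add: image_mset_mset_set inj_on_def)
  ultimately show ?case
    using insert by (simp add: image_mset.compositionality comp_def)
qed simp

text \<open>Equality of the image multisets means that over each key \<open>k\<close> the fibres of
  \<open>f\<close> and \<open>g\<close> have equally many elements, and bijections between fibres
  glue together. This turns the search for a link into an equation.\<close>

lemma ex_bij_betw_iff_image_mset_eq:
  assumes "finite A" "finite B"
  shows "(\<exists>\<phi>. bij_betw \<phi> A B \<and> (\<forall>a\<in>A. g (\<phi> a) = f a)) \<longleftrightarrow>
    image_mset f (mset_set A) = image_mset g (mset_set B)"
proof
  assume "\<exists>\<phi>. bij_betw \<phi> A B \<and> (\<forall>a\<in>A. g (\<phi> a) = f a)"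
  then obtain \<phi> where \<phi>: "bij_betw \<phi> A B" "\<forall>a\<in>A. g (\<phi> a) = f a" by blast
  then have "mset_set B = image_mset \<phi> (mset_set A)"
    by (simp add: bij_betw_def image_mset_mset_set)
  then show "image_mset f (mset_set A) = image_mset g (mset_set B)"
    using \<phi> assms by (auto simp: image_mset.compositionality intro!: image_mset_cong)
next
  assume eq: "image_mset f (mset_set A) = image_mset g (mset_set B)"
  define A' B' where "A' k = {a \<in> A. f a = k}" and "B' k = {b \<in> B. g b = k}" for k
  have "card (A' k) = card (B' k)" for k
    using arg_cong[OF eq, of "\<lambda>M. count M k"] assms
    by (simp add: A'_def B'_def count_image_mset' Int_def conj_commute vimage_def eq_commute
        flip: sum.inter_filter)
  then have "\<forall>k. \<exists>h. bij_betw h (A' k) (B' k)"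
    using assms by (auto simp: A'_def B'_def intro!: finite_same_card_bij)
  then obtain h where h: "\<And>k. bij_betw (h k) (A' k) (B' k)" by metis
  have hB: "h (f a) a \<in> B \<and> g (h (f a) a) = f a" if "a \<in> A" for a
    using bij_betwE[OF h[of "f a"]] that by (auto simp: A'_def B'_def)
  have "bij_betw (\<lambda>a. h (f a) a) A B"
    unfolding bij_betw_def
  proof (intro conjI inj_onI set_eqI iffI)
    fix a a' assume "a \<in> A" "a' \<in> A" and e: "h (f a) a = h (f a') a'"
    \<comment> \<open>\<open>g\<close> recovers the key from the image, so points with equal images
      lie in the same fibre.\<close>
    moreover from this have "f a = f a'" by (metis hB)
    ultimately show "a = a'"
      using bij_betw_imp_inj_on[OF h[of "f a"]] by (auto simp: A'_def inj_on_def)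
  next
    fix b assume "b \<in> B"
    then obtain a where "a \<in> A" "f a = g b" "b = h (g b) a"
      using bij_betw_imp_surj_on[OF h[of "g b"]] by (auto simp: A'_def B'_def)
    then show "b \<in> (\<lambda>a. h (f a) a) ` A" by (intro image_eqI[of _ _ a]) auto
  qed (use hB in auto)
  then show "\<exists>\<phi>. bij_betw \<phi> A B \<and> (\<forall>a\<in>A. g (\<phi> a) = f a)"
    using hB by (intro exI[of _ "\<lambda>a. h (f a) a"]) auto
qed

section \<open>Row multisets\<close>

definition row_mset :: "nat \<Rightarrow> tableau \<Rightarrow> nat \<Rightarrow> label multiset" where
  "row_mset c T p = image_mset (\<lambda>d. T (p, d)) (mset_set {1..c})"

lemma size_row_mset [simp]: "size (row_mset c T p) = c"
  by (simp add: row_mset_def)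

lemma size_filter_row_mset:
  "size (filter_mset P (row_mset c T p)) = card {d \<in> {1..c}. P (T (p, d))}"
  by (simp add: row_mset_def filter_mset_image_mset)

lemma fillings_mem:
  assumes "T \<in> fillings r c n s" "p \<in> {1..r}" "d \<in> {1..c}"
  shows "T (p, d) \<in> labels n s"
  using assms PiE_mem[of T "boxes r c" "\<lambda>_. labels n s" "(p, d)"]
  by (simp add: fillings_def boxes_def)

lemma set_row_mset_subset:
  assumes "T \<in> fillings r c n s" "p \<in> {1..r}"
  shows "set_mset (row_mset c T p) \<subseteq> labels n s"
  using fillings_mem[OF assms] by (auto simp: row_mset_def)

lemma finite_labels [simp]: "finite (labels n s)"
  by (simp add: labels_def)

text \<open>The subtraction does not truncate for the rows \<open>p < p'\<close> of a semi-standard tableau.\<close>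

definition slack :: "label \<Rightarrow> label multiset \<Rightarrow> label multiset \<Rightarrow> nat" where
  "slack l M M' = size (filter_mset (\<lambda>x. x < l) M) - size (filter_mset (\<lambda>x. x \<le> l) M')"

text \<open>In every column where row \<open>p'\<close> has an entry at most \<open>l\<close>, the
  higher row \<open>p\<close> has an entry below \<open>l\<close>. The column condition thus leaves
  a trace in the row multisets alone.\<close>

lemma semistandard_filter_le:
  assumes "semistandard r c T" "p \<in> {1..r}" "p' \<in> {1..r}" "p < p'"
  shows "size (filter_mset (\<lambda>x. x \<le> l) (row_mset c T p'))
    \<le> size (filter_mset (\<lambda>x. x < l) (row_mset c T p))"
  unfolding size_filter_row_mset
proof (rule card_mono)
  have "T (p, d) < T (p', d)" if "d \<in> {1..c}" for d
    using assms that strict_mono_onD[of "{1..r}" "\<lambda>p. T (p, d)"]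
    by (simp add: semistandard_def)
  then show "{d \<in> {1..c}. T (p', d) \<le> l} \<subseteq> {d \<in> {1..c}. T (p, d) < l}"
    using less_le_trans by blast
qed simp

text \<open>Converse of \<open>semistandard_filter_le\<close> for sorted rows: if column
  \<open>d\<close> fails, then counting against its lower entry finds at least \<open>d\<close>
  labels in row \<open>p'\<close> but at most \<open>d - 1\<close> in row \<open>p\<close>. Testing
  only \<open>l\<close> in \<open>labels n s\<close> keeps the inequalities finite in
  number.\<close>

lemma semistandardI_filter_le:
  assumes T: "T \<in> fillings r c n s"
    and rows: "\<And>p. p \<in> {1..r} \<Longrightarrow> mono_on {1..c} (\<lambda>d. T (p, d))"
    and le: "\<And>p p' l. \<lbrakk>p \<in> {1..r}; p' \<in> {1..r}; p < p'; l \<in> labels n s\<rbrakk> \<Longrightarrow>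
      size (filter_mset (\<lambda>x. x \<le> l) (row_mset c T p'))
        \<le> size (filter_mset (\<lambda>x. x < l) (row_mset c T p))"
  shows "semistandard r c T"
  unfolding semistandard_def
proof (intro conjI ballI strict_mono_onI rows)
  fix d p p' assume d: "d \<in> {1..c}" and p: "p \<in> {1..r}" "p' \<in> {1..r}" "p < p'"
  show "T (p, d) < T (p', d)"
  proof (rule ccontr)
    assume ge: "\<not> T (p, d) < T (p', d)"
    define l where "l = T (p', d)"
    have "l \<in> labels n s"
      unfolding l_def using fillings_mem[OF T p(2) d] .
    have "{1..d} \<subseteq> {e \<in> {1..c}. T (p', e) \<le> l}"
      using d monotone_onD[OF rows[OF p(2)]] by (auto simp: l_def)
    then have "d \<le> card {e \<in> {1..c}. T (p', e) \<le> l}"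
      using card_mono[of "{e \<in> {1..c}. T (p', e) \<le> l}" "{1..d}"] by simp
    \<comment> \<open>From column \<open>d\<close> on, the entries of row \<open>p\<close> are at
      least \<open>T (p, d)\<close>, which is at least \<open>l\<close>.\<close>
    moreover have "{e \<in> {1..c}. T (p, e) < l} \<subseteq> {1..<d}"
    proof safe
      fix e assume e: "e \<in> {1..c}" "T (p, e) < l"
      have "\<not> d \<le> e"
        using e d ge monotone_onD[OF rows[OF p(1)], of d e] by (auto simp: l_def)
      then show "e \<in> {1..<d}" using e by auto
    qed
    then have "card {e \<in> {1..c}. T (p, e) < l} \<le> d - 1"
      using card_mono[of "{1..<d}"] by fastforce
    \<comment> \<open>Columns start at 1, so \<open>d \<le> d - 1\<close> is absurd.\<close>
    ultimately show False
      using le[OF p \<open>l \<in> labels n s\<close>, unfolded size_filter_row_mset] d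
      unfolding atLeastAtMost_iff by linarith
  qed
qed

text \<open>Sorting each multiset yields the rows.\<close>

lemma ex_filling_row_mset:
  assumes "\<And>p. p \<in> {1..r} \<Longrightarrow> size (M p) = c"
    and "\<And>p. p \<in> {1..r} \<Longrightarrow> set_mset (M p) \<subseteq> labels n s"
  obtains T where "T \<in> fillings r c n s"
    and "\<And>p. p \<in> {1..r} \<Longrightarrow> mono_on {1..c} (\<lambda>d. T (p, d))"
    and "\<And>p. p \<in> {1..r} \<Longrightarrow> row_mset c T p = M p"
proof -
  define L where "L p = sorted_list_of_multiset (M p)" for p
  have L: "mset (L p) = M p" "sorted (L p)" for p
    by (simp_all add: L_def)
  then have len: "length (L p) = c" if "p \<in> {1..r}" for p
    using assms(1)[OF that] by (metis size_mset)
  \<comment> \<open>Columns are numbered from 1 and list positions from 0; the restriction to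
    \<open>boxes r c\<close> makes the function extensional, as \<open>fillings\<close>
    demands.\<close>
  define T where "T = (\<lambda>(p, d)\<in>boxes r c. L p ! (d - 1))"
  have T: "T (p, d) = L p ! (d - 1)" if "p \<in> {1..r}" "d \<in> {1..c}" for p d
    using that by (simp add: T_def boxes_def)
  show ?thesis
  proof (rule that[of T])
    have "L p ! (d - 1) \<in> labels n s" if "p \<in> {1..r}" "d \<in> {1..c}" for p d
    proof -
      have "L p ! (d - 1) \<in> set (L p)" using that len[of p] by (intro nth_mem) auto
      then show ?thesis using assms(2)[of p] that L(1)[of p] by (metis set_mset_mset subsetD)
    qed
    then show "T \<in> fillings r c n s"
      by (auto simp: T_def fillings_def boxes_def)
    fix p assume p: "p \<in> {1..r}"
    show "mono_on {1..c} (\<lambda>d. T (p, d))"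
      using T[OF p] len[OF p] L(2)[of p] by (auto intro!: monotone_onI sorted_nth_mono)
    have "mset_set {1..c} = image_mset Suc (mset_set {0..<c})"
      by (simp add: image_mset_mset_set image_Suc_atLeastLessThan atLeastLessThanSuc_atLeastAtMost)
    then have "row_mset c T p = image_mset (\<lambda>d. T (p, Suc d)) (mset_set {0..<c})"
      by (simp add: row_mset_def image_mset.compositionality comp_def)
    also have "\<dots> = image_mset ((!) (L p)) (mset_set {0..<c})"
      using T[OF p] by (intro image_mset_cong) auto
    also have "\<dots> = mset (map ((!) (L p)) [0..<c])"
      by simp
    also have "map ((!) (L p)) [0..<c] = L p"
      using len[OF p] map_nth by blast
    finally show "row_mset c T p = M p" using L(1) by simp
  qed
qed

text \<open>Row multisets are subtracted and the results sorted. For \<open>p < p'\<close> the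
  column inequality of the difference has as its slack that of \<open>T\<close> minus that of
  \<open>T1\<close>, which the hypothesis on slacks makes nonnegative.\<close>

lemma ex_semistandard_diff:
  assumes T: "T \<in> fillings r c n s" "semistandard r c T"
    and T1: "T1 \<in> fillings r c1 n s" "semistandard r c1 T1"
    and rows: "\<And>p. p \<in> {1..r} \<Longrightarrow> row_mset c1 T1 p \<subseteq># row_mset c T p"
    and slack: "\<And>p p' l. \<lbrakk>p \<in> {1..r}; p' \<in> {1..r}; l \<in> labels n s\<rbrakk> \<Longrightarrow>
      slack l (row_mset c1 T1 p) (row_mset c1 T1 p') \<le> slack l (row_mset c T p) (row_mset c T p')"
  shows "\<exists>T2\<in>fillings r (c - c1) n s. semistandard r (c - c1) T2 \<and>
    (\<forall>p\<in>{1..r}. row_mset c T p = row_mset c1 T1 p + row_mset (c - c1) T2 p)"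
proof -
  define M where "M p = row_mset c T p - row_mset c1 T1 p" for p
  have M: "row_mset c T p = row_mset c1 T1 p + M p" if "p \<in> {1..r}" for p
    using rows[OF that] by (simp add: M_def)
  obtain T2 where T2: "T2 \<in> fillings r (c - c1) n s"
    "\<And>p. p \<in> {1..r} \<Longrightarrow> mono_on {1..c - c1} (\<lambda>d. T2 (p, d))"
    "\<And>p. p \<in> {1..r} \<Longrightarrow> row_mset (c - c1) T2 p = M p"
  proof (rule ex_filling_row_mset[of r M "c - c1" n s])
    fix p assume p: "p \<in> {1..r}"
    show "size (M p) = c - c1"
      using rows[OF p] by (simp add: M_def size_Diff_submset)
    show "set_mset (M p) \<subseteq> labels n s"
      using set_row_mset_subset[OF T(1) p] by (auto simp: M_def dest: in_diffD)
  qed (use that in blast)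
  show ?thesis
  proof (intro bexI[OF _ T2(1)] conjI ballI)
    show "semistandard r (c - c1) T2"
    proof (rule semistandardI_filter_le[OF T2(1,2)])
      fix p p' l assume p: "p \<in> {1..r}" "p' \<in> {1..r}" "p < p'" and l: "l \<in> labels n s"
      show "size (filter_mset (\<lambda>x. x \<le> l) (row_mset (c - c1) T2 p'))
          \<le> size (filter_mset (\<lambda>x. x < l) (row_mset (c - c1) T2 p))"
        \<comment> \<open>The column inequalities of \<open>T\<close> and \<open>T1\<close> exclude
          truncation, so the comparison of slacks can be rearranged additively.\<close>
        using slack[OF p(1,2) l] semistandard_filter_le[OF T(2) p, of l]
          semistandard_filter_le[OF T1(2) p, of l]
        by (simp add: slack_def M[OF p(1)] M[OF p(2)] T2(3)[OF p(1)] T2(3)[OF p(2)])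
    qed
    show "row_mset c T p = row_mset c1 T1 p + row_mset (c - c1) T2 p" if "p \<in> {1..r}" for p
      using M T2(3) that by simp
  qed
qed

section \<open>Linked pairs\<close>

text \<open>The exponent vector of the monomial read off from the minus tableau, as a multiset of
  variable indices: a label \<open>iq\<close> in row \<open>p\<close> gives
  \<open>(i, q, p)\<close>. Summing over rows makes additivity in the row multisets evident.\<close>

definition minus_vars :: "nat \<Rightarrow> nat \<Rightarrow> tableau \<Rightarrow> (nat \<times> nat \<times> nat) multiset" where
  "minus_vars r1 c T = (\<Sum>p\<in>{1..r1}. image_mset (\<lambda>(i, q). (i, q, p)) (row_mset c T p))"

definition plus_vars :: "nat \<Rightarrow> nat \<Rightarrow> tableau \<Rightarrow> (nat \<times> nat \<times> nat) multiset" where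
  "plus_vars r2 c T = (\<Sum>q\<in>{1..r2}. image_mset (\<lambda>(i, p). (i, q, p)) (row_mset c T q))"

lemma minus_vars_eq:
  "minus_vars r1 c T =
    image_mset (\<lambda>b. (fst (T b), snd (T b), fst b)) (mset_set (boxes r1 c))"
  unfolding minus_vars_def boxes_def
  by (subst image_mset_mset_set_Times)
    (simp_all add: row_mset_def image_mset.compositionality comp_def case_prod_beta)

lemma plus_vars_eq:
  "plus_vars r2 c T =
    image_mset (\<lambda>b. (fst (T b), fst b, snd (T b))) (mset_set (boxes r2 c))"
  unfolding plus_vars_def boxes_def
  by (subst image_mset_mset_set_Times)
    (simp_all add: row_mset_def image_mset.compositionality comp_def case_prod_beta)

lemma minus_vars_add:
  assumes "\<And>p. p \<in> {1..r} \<Longrightarrow> row_mset c T p = row_mset c1 T1 p + row_mset c2 T2 p"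
  shows "minus_vars r c T = minus_vars r c1 T1 + minus_vars r c2 T2"
  unfolding minus_vars_def
  by (subst sum.distrib[symmetric], rule sum.cong) (simp_all add: assms)

lemma plus_vars_add:
  assumes "\<And>p. p \<in> {1..r} \<Longrightarrow> row_mset c T p = row_mset c1 T1 p + row_mset c2 T2 p"
  shows "plus_vars r c T = plus_vars r c1 T1 + plus_vars r c2 T2"
  unfolding plus_vars_def
  by (subst sum.distrib[symmetric], rule sum.cong) (simp_all add: assms)

text \<open>Attach to each box the index of its variable. A link is exactly a bijection of boxes
  preserving this index, so it exists when the two exponent vectors agree, and only then.\<close>

lemma ex_is_link_iff:
  "(\<exists>\<phi>. is_link r1 r2 T \<phi>) \<longleftrightarrow>
    minus_vars r1 (cols (scale T) r2) (minus_tab T) =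
    plus_vars r2 (cols (scale T) r1) (plus_tab T)"
proof -
  define A where "A = boxes r1 (cols (scale T) r2)"
  define B where "B = boxes r2 (cols (scale T) r1)"
  have "is_link r1 r2 T \<phi> \<longleftrightarrow> bij_betw \<phi> A B \<and>
      (\<forall>b\<in>A. (fst (plus_tab T (\<phi> b)), fst (\<phi> b), snd (plus_tab T (\<phi> b))) =
        (fst (minus_tab T b), snd (minus_tab T b), fst b))" for \<phi>
    unfolding is_link_def minus_boxes_def plus_boxes_def A_def[symmetric] B_def[symmetric]
    by (auto simp: prod_eq_iff)
  moreover have "finite A" "finite B" by (simp_all add: A_def B_def boxes_def)
  ultimately show ?thesis
    by (simp add: ex_bij_betw_iff_image_mset_eq[where
          f = "\<lambda>b. (fst (minus_tab T b), snd (minus_tab T b), fst b)" and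
          g = "\<lambda>b. (fst (plus_tab T b), fst b, snd (plus_tab T b))"]
        minus_vars_eq plus_vars_eq del: prod.inject flip: A_def B_def)
qed

text \<open>The monomial sees only the multiset of variables, so the additivity in
  \<open>plus_vars_add\<close> becomes multiplicativity.\<close>

lemma Mon_eq_prod_mset:
  "Mon r1 r2 T = (\<Prod>(i, q, p)\<in>#plus_vars r2 (cols (scale T) r1) (plus_tab T). var i q p)"
  by (simp add: Mon_def plus_vars_eq plus_boxes_def image_mset.compositionality comp_def
      case_prod_beta prod_unfold_prod_mset)

section \<open>Scales and their numerators\<close>

lemma cols_of_nat_div_gcd:
  assumes "g dvd r" "g > 0"
  shows "cols (of_nat m / of_nat g) r = m * (r div g)"
proof -
  \<comment> \<open>Divisibility makes the number under the floor an integer, so the number of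
    columns is linear in \<open>m\<close>.\<close>
  have "(of_nat m / of_nat g * of_nat r :: rat) = of_nat (m * (r div g))"
    using assms by (auto elim!: dvdE)
  then show ?thesis unfolding cols_def by (metis floor_of_nat nat_int)
qed

text \<open>The numerator of the scale over the denominator \<open>gcd r1 r2\<close>, a natural
  number as Dickson's lemma requires. For linked pairs the floor is exact.\<close>

definition scale_num :: "nat \<Rightarrow> nat \<Rightarrow> tableaux_pair \<Rightarrow> nat" where
  "scale_num r1 r2 T = nat \<lfloor>scale T * of_nat (gcd r1 r2)\<rfloor>"

lemma linked_pairs_scale:
  assumes "T \<in> linked_pairs n r1 r2" "r1 > 0"
  shows "scale T = of_nat (scale_num r1 r2 T) / of_nat (gcd r1 r2)"
  using assms by (auto simp: linked_pairs_def scale_num_def)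

text \<open>A fixed scale fixes both rectangles, and a finite rectangle has finitely many
  extensional fillings by a finite set of labels.\<close>

lemma finite_linked_pairs_scale: "finite {T \<in> linked_pairs n r1 r2. scale T = a}"
proof (rule finite_subset)
  let ?M = "fillings r1 (cols a r2) n r2" and ?P = "fillings r2 (cols a r1) n r1"
  show "{T \<in> linked_pairs n r1 r2. scale T = a}
      \<subseteq> (\<lambda>(t, t'). \<lparr>scale = a, minus_tab = t, plus_tab = t'\<rparr>) ` (?M \<times> ?P)"
  proof
    fix T assume "T \<in> {T \<in> linked_pairs n r1 r2. scale T = a}"
    then show "T \<in> (\<lambda>(t, t'). \<lparr>scale = a, minus_tab = t, plus_tab = t'\<rparr>) ` (?M \<times> ?P)"
      by (intro image_eqI[of _ _ "(minus_tab T, plus_tab T)"]) (auto simp: linked_pairs_def)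
  qed
  show "finite ((\<lambda>(t, t'). \<lparr>scale = a, minus_tab = t, plus_tab = t'\<rparr>) ` (?M \<times> ?P))"
    unfolding fillings_def boxes_def by (intro finite_imageI finite_cartesian_product finite_PiE) auto
qed

text \<open>\<open>R T p\<close> stands for the multiset of row \<open>p\<close> in one tableau of
  \<open>T\<close>; the parameter \<open>R\<close> lets both tableaux share the definition.
  Comparing counts allows rows to be subtracted, comparing slacks keeps the column condition
  afterwards.\<close>

definition row_coords :: "nat \<Rightarrow> label set \<Rightarrow> ('a \<Rightarrow> nat \<Rightarrow> label multiset) \<Rightarrow> ('a \<Rightarrow> nat) set" where
  "row_coords r L R =
     (\<lambda>(p, l) T. count (R T p) l) ` ({1..r} \<times> L) \<union>
     (\<lambda>(p, p', l) T. slack l (R T p) (R T p')) ` ({1..r} \<times> {1..r} \<times> L)"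

lemma row_coords_slackD:
  assumes "\<forall>f\<in>row_coords r L R. f T1 \<le> f T"
    and "p \<in> {1..r}" "p' \<in> {1..r}" "l \<in> L"
  shows "slack l (R T1 p) (R T1 p') \<le> slack l (R T p) (R T p')"
proof -
  have "(\<lambda>T. slack l (R T p) (R T p')) \<in> row_coords r L R"
    unfolding row_coords_def using assms(2-)
    by (intro UnI2 image_eqI[of _ _ "(p, p', l)"]) auto
  from bspec[OF assms(1) this] show ?thesis by simp
qed

lemma row_coords_subseteqD:
  assumes "\<forall>f\<in>row_coords r L R. f T1 \<le> f T"
    and p: "p \<in> {1..r}" and "set_mset (R T1 p) \<subseteq> L"
  shows "R T1 p \<subseteq># R T p"
proof (rule mset_subset_eqI)
  fix l
  show "count (R T1 p) l \<le> count (R T p) l"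
  proof (cases "l \<in> L")
    case True
    then have "(\<lambda>T. count (R T p) l) \<in> row_coords r L R"
      unfolding row_coords_def using p by (intro UnI1 image_eqI[of _ _ "(p, l)"]) auto
    from bspec[OF assms(1) this] show ?thesis by simp
  next
    \<comment> \<open>Labels outside \<open>L\<close> have no coordinate, but they do not occur in
      the smaller row.\<close>
    case False
    then have "count (R T1 p) l = 0" using assms(3) by (auto simp: count_eq_zero_iff)
    then show ?thesis by simp
  qed
qed

definition coords :: "nat \<Rightarrow> nat \<Rightarrow> nat \<Rightarrow> (tableaux_pair \<Rightarrow> nat) set" where
  "coords n r1 r2 = {scale_num r1 r2} \<union>
     row_coords r1 (labels n r2) (\<lambda>T. row_mset (cols (scale T) r2) (minus_tab T)) \<union>
     row_coords r2 (labels n r1) (\<lambda>T. row_mset (cols (scale T) r1) (plus_tab T))"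

lemma finite_coords: "finite (coords n r1 r2)"
  by (simp add: coords_def row_coords_def)

text \<open>The cofactor is the difference of \<open>T\<close> and \<open>T1\<close>, taken in both
  tableaux. The link equations are linear and pass to the difference; the scale coordinate together
  with \<open>neq\<close> makes its scale positive.\<close>

lemma ex_cofactor:
  assumes r: "r1 > 0" "r2 > 0"
    and T: "T \<in> semistandard_pairs n r1 r2" and T1: "T1 \<in> semistandard_pairs n r1 r2"
    and coords: "\<forall>f\<in>coords n r1 r2. f T1 \<le> f T"
    and neq: "scale T1 \<noteq> scale T"
  shows "\<exists>T2\<in>nonempty_semistandard_pairs n r1 r2. Mon r1 r2 T = Mon r1 r2 T1 * Mon r1 r2 T2"
proof -
  define g where "g = gcd r1 r2"
  have g: "g dvd r1" "g dvd r2" "g > 0" using r by (auto simp: g_def)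
  define m where "m = scale_num r1 r2 T"
  define m1 where "m1 = scale_num r1 r2 T1"
  have sc: "scale T = of_nat m / of_nat g" "scale T1 = of_nat m1 / of_nat g"
    using T T1 r linked_pairs_scale unfolding m_def m1_def g_def semistandard_pairs_def by auto
  have "m1 \<le> m" using coords by (auto simp: coords_def m_def m1_def)
  moreover have "m1 \<noteq> m" using neq sc by auto
  ultimately have m: "m1 < m" by simp
  \<comment> \<open>The difference of the two scales, in the form that a linked pair requires;
    \<open>m1 < m\<close> makes the subtraction exact.\<close>
  define a2 :: rat where "a2 = of_nat (m - m1) / of_nat g"
  \<comment> \<open>By linearity in the numerator, the new tableaux have just the width that
    subtracting the rows leaves.\<close>
  have c: "cols a2 r = cols (scale T) r - cols (scale T1) r" if "g dvd r" for r
    unfolding a2_def sc using that g(3) by (simp add: cols_of_nat_div_gcd diff_mult_distrib)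
  note defs = semistandard_pairs_def linked_pairs_def
  let ?c = "cols (scale T)" and ?c1 = "cols (scale T1)"
  have minus_tabs: "minus_tab T \<in> fillings r1 (?c r2) n r2" "semistandard r1 (?c r2) (minus_tab T)"
    "minus_tab T1 \<in> fillings r1 (?c1 r2) n r2" "semistandard r1 (?c1 r2) (minus_tab T1)"
    and plus_tabs: "plus_tab T \<in> fillings r2 (?c r1) n r1" "semistandard r2 (?c r1) (plus_tab T)"
    "plus_tab T1 \<in> fillings r2 (?c1 r1) n r1" "semistandard r2 (?c1 r1) (plus_tab T1)"
    and links: "minus_vars r1 (?c r2) (minus_tab T) = plus_vars r2 (?c r1) (plus_tab T)"
    "minus_vars r1 (?c1 r2) (minus_tab T1) = plus_vars r2 (?c1 r1) (plus_tab T1)"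
    using T T1 by (simp_all add: defs ex_is_link_iff)

  have minus_coords: "\<forall>f\<in>row_coords r1 (labels n r2) (\<lambda>T. row_mset (cols (scale T) r2) (minus_tab T)).
      f T1 \<le> f T"
    using coords unfolding coords_def by blast
  have plus_coords: "\<forall>f\<in>row_coords r2 (labels n r1) (\<lambda>T. row_mset (cols (scale T) r1) (plus_tab T)).
      f T1 \<le> f T"
    using coords unfolding coords_def by blast

  have "\<exists>M2\<in>fillings r1 (cols a2 r2) n r2. semistandard r1 (cols a2 r2) M2 \<and>
    (\<forall>p\<in>{1..r1}. row_mset (?c r2) (minus_tab T) p =
      row_mset (?c1 r2) (minus_tab T1) p + row_mset (cols a2 r2) M2 p)"
    unfolding c[OF \<open>g dvd r2\<close>]
  proof (rule ex_semistandard_diff[OF minus_tabs])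
    show "row_mset (?c1 r2) (minus_tab T1) p \<subseteq># row_mset (?c r2) (minus_tab T) p"
      if "p \<in> {1..r1}" for p
      using row_coords_subseteqD[OF minus_coords that] set_row_mset_subset[OF minus_tabs(3) that] by blast
  qed (rule row_coords_slackD[OF minus_coords])
  then obtain M2 where M2: "M2 \<in> fillings r1 (cols a2 r2) n r2" "semistandard r1 (cols a2 r2) M2"
    and M2_rows: "\<And>p. p \<in> {1..r1} \<Longrightarrow> row_mset (?c r2) (minus_tab T) p =
      row_mset (?c1 r2) (minus_tab T1) p + row_mset (cols a2 r2) M2 p"
    by blast

  have "\<exists>P2\<in>fillings r2 (cols a2 r1) n r1. semistandard r2 (cols a2 r1) P2 \<and>
    (\<forall>p\<in>{1..r2}. row_mset (?c r1) (plus_tab T) p =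
      row_mset (?c1 r1) (plus_tab T1) p + row_mset (cols a2 r1) P2 p)"
    unfolding c[OF \<open>g dvd r1\<close>]
  proof (rule ex_semistandard_diff[OF plus_tabs])
    show "row_mset (?c1 r1) (plus_tab T1) p \<subseteq># row_mset (?c r1) (plus_tab T) p"
      if "p \<in> {1..r2}" for p
      using row_coords_subseteqD[OF plus_coords that] set_row_mset_subset[OF plus_tabs(3) that] by blast
  qed (rule row_coords_slackD[OF plus_coords])
  then obtain P2 where P2: "P2 \<in> fillings r2 (cols a2 r1) n r1" "semistandard r2 (cols a2 r1) P2"
    and P2_rows: "\<And>p. p \<in> {1..r2} \<Longrightarrow> row_mset (?c r1) (plus_tab T) p =
      row_mset (?c1 r1) (plus_tab T1) p + row_mset (cols a2 r1) P2 p"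
    by blast

  have minus: "minus_vars r1 (?c r2) (minus_tab T) =
      minus_vars r1 (?c1 r2) (minus_tab T1) + minus_vars r1 (cols a2 r2) M2"
    by (rule minus_vars_add) (simp add: M2_rows)
  have plus: "plus_vars r2 (?c r1) (plus_tab T) =
      plus_vars r2 (?c1 r1) (plus_tab T1) + plus_vars r2 (cols a2 r1) P2"
    by (rule plus_vars_add) (simp add: P2_rows)

  define T2 where "T2 = \<lparr>scale = a2, minus_tab = M2, plus_tab = P2\<rparr>"
  \<comment> \<open>Cancel the link equation of \<open>T1\<close> from that of
    \<open>T\<close>.\<close>
  have "minus_vars r1 (cols a2 r2) M2 = plus_vars r2 (cols a2 r1) P2"
    using minus plus links by simp
  then have "\<exists>\<phi>. is_link r1 r2 T2 \<phi>" by (simp add: ex_is_link_iff T2_def)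
  moreover have "\<exists>k::nat. a2 = of_nat k / of_nat (gcd r1 r2)" unfolding a2_def g_def by blast
  moreover have "a2 \<noteq> 0" using m g(3) by (simp add: a2_def)
  ultimately have "T2 \<in> nonempty_semistandard_pairs n r1 r2"
    using M2 P2 by (simp add: nonempty_semistandard_pairs_def defs T2_def)
  moreover have "Mon r1 r2 T = Mon r1 r2 T1 * Mon r1 r2 T2"
    by (simp add: Mon_eq_prod_mset plus T2_def)
  ultimately show ?thesis by blast
qed

section \<open>Finiteness of the primitive pairs\<close>

theorem theorem1p1:
  fixes r1 r2 n :: nat
  assumes "r1 > 0" and "r2 > 0" and "n > 0"
  shows "finite (primitive_pairs n r1 r2)"
proof (rule ccontr)
  let ?P = "primitive_pairs n r1 r2"
  assume inf: "infinite ?P"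
  have sub: "?P \<subseteq> nonempty_semistandard_pairs n r1 r2" "?P \<subseteq> semistandard_pairs n r1 r2"
    "?P \<subseteq> linked_pairs n r1 r2"
    by (auto simp: primitive_pairs_def nonempty_semistandard_pairs_def semistandard_pairs_def)
  have "infinite (scale ` ?P)"
  proof
    assume "finite (scale ` ?P)"
    then have "finite (\<Union>a\<in>scale ` ?P. {T \<in> linked_pairs n r1 r2. scale T = a})"
      using finite_linked_pairs_scale by blast
    moreover have "?P \<subseteq> (\<Union>a\<in>scale ` ?P. {T \<in> linked_pairs n r1 r2. scale T = a})"
      using sub by auto
    ultimately show False using inf finite_subset by blast
  qed
  \<comment> \<open>An injective sequence of scales, lifted to primitive pairs, ensures that the two
    pairs from Dickson's lemma differ in scale.\<close>
  then obtain a :: "nat \<Rightarrow> rat" where a: "inj a" "range a \<subseteq> scale ` ?P"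
    using infinite_countable_subset by blast
  then have "\<forall>k. \<exists>T\<in>?P. scale T = a k" by (metis imageE rangeI subsetD)
  then obtain S where S: "\<And>k. S k \<in> ?P" "\<And>k. scale (S k) = a k" by metis
  obtain i j where ij: "i < j" "\<forall>f\<in>coords n r1 r2. f (S i) \<le> f (S j)"
    using dickson[OF finite_coords] by blast
  have "S i \<in> semistandard_pairs n r1 r2" "S j \<in> semistandard_pairs n r1 r2"
    using S(1) sub(2) by auto
  moreover have "scale (S i) \<noteq> scale (S j)" using a(1) ij(1) S(2) by (auto dest: injD)
  ultimately obtain T2 where "T2 \<in> nonempty_semistandard_pairs n r1 r2"
    "Mon r1 r2 (S j) = Mon r1 r2 (S i) * Mon r1 r2 T2"
    using ex_cofactor[OF assms(1,2) _ _ ij(2)] by blast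
  moreover have "S i \<in> nonempty_semistandard_pairs n r1 r2" using S(1) sub(1) by blast
  \<comment> \<open>\<open>S i\<close> and \<open>T2\<close> factor the monomial of
    \<open>S j\<close>, against its primitivity.\<close>
  ultimately show False using S(1)[of j] by (auto simp: primitive_pairs_def)
qed

end
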